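(* Let $d,k$ be positive integers. Then $\tau_d > 0$ and \[ s(d,k) \le \frac{k}{d!\,\tau_d}. \]
   Context: For $d \ge 1$, $\tau_d$ is the minimum of $\beta_1\beta_2\cdots\beta_d$ over all $(\beta_1,\dots,\beta_{d+1}) \in \mathbb{R}^{d+1}$ satisfying $\beta_1 \ge \cdots \ge \beta_{d+1} \ge 0$, $\beta_1+\cdots+\beta_{d+1}=1$, and, for every $t \in \{1,\dots,d\}$, $\prod_{i=1}^t (\beta_i - \beta_{d+1}) \le \sum_{j=t+1}^{d+1} (\beta_j - \beta_{d+1}) + (d+1)\beta_{d+1}$. A lattice polytope in $\mathbb{R}^d$ is a polytope with all vertices in $\mathbb{Z}^d$; $\mathcal{S}^d(k)$ is the family of $d$-dimensional lattice simplices in $\mathbb{R}^d$ with exactly $k$ interior lattice points, and $s(d,k) := \max\{\operatorname{vol}(S): S\in\mathcal{S}^d(k)\}$, with $\operatorname{vol}$ the Lebesgue measure normalized so that $\operatorname{vol}([0,1]^d)=1$. *)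

theory Defs
  imports "HOL-Analysis.Analysis"
begin

text \<open>Feasible vectors (beta_1,...,beta_{d+1}) for tau_d; indices 1..d+1 of a function nat => real.\<close>
definition tau_feasible :: "nat \<Rightarrow> (nat \<Rightarrow> real) \<Rightarrow> bool" where
  "tau_feasible d \<beta> \<longleftrightarrow>
     (\<forall>i\<in>{1..d}. \<beta> (Suc i) \<le> \<beta> i) \<and> 0 \<le> \<beta> (d+1) \<and>
     (\<Sum>i=1..d+1. \<beta> i) = 1 \<and>
     (\<forall>t\<in>{1..d}. (\<Prod>i=1..t. \<beta> i - \<beta> (d+1))
                   \<le> (\<Sum>j=t+1..d+1. \<beta> j - \<beta> (d+1)) + real (d+1) * \<beta> (d+1))"

text \<open>tau_d: the minimum (here: infimum, which is attained) of beta_1 ... beta_d over feasible vectors.\<close>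
definition tau :: "nat \<Rightarrow> real" where
  "tau d = Inf ((\<lambda>\<beta>. \<Prod>i=1..d. \<beta> i) ` {\<beta>. tau_feasible d \<beta>})"

definition lattice_point :: "real^'n \<Rightarrow> bool" where
  "lattice_point x \<longleftrightarrow> (\<forall>i. x $ i \<in> \<int>)"

definition lattice_simplices :: "'n itself \<Rightarrow> nat \<Rightarrow> (real^'n::finite) set set" where
  "lattice_simplices _ k = {S. \<exists>V. finite V \<and> card V = CARD('n) + 1 \<and> \<not> affine_dependent V \<and>
        (\<forall>v\<in>V. lattice_point v) \<and> S = convex hull V \<and>
        card {x \<in> interior S. lattice_point x} = k}"

end

theory Submission
  imports Defs
begin

text \<open>
  Measure the depth of an interior lattice point of the simplex by its smallest barycentric
  coordinate, and let \<open>\<beta>\<close> be the decreasingly ordered coordinates of a deepest one, \<open>p\<close>. If \<open>\<beta>\<close>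
  violated the \<open>t\<close>-th inequality defining \<open>\<tau>\<^sub>d\<close>, Minkowski's theorem would give integers
  \<open>z\<^sub>1, \<dots>, z\<^sub>t\<close> with sum \<open>q \<ge> 1\<close> such that \<open>\<bar>q \<beta>\<^sub>i - z\<^sub>i\<bar> < \<beta>\<^sub>i - \<beta>\<^bsub>d+1\<^esub>\<close> for all \<open>i \<le> t\<close>, and
  \<open>(q + 1) \<beta> - z\<close> would be the coordinate vector of a deeper lattice point. So \<open>\<beta>\<close> is feasible.

  If \<open>d! vol S \<beta>\<^sub>1 \<dots> \<beta>\<^sub>d > k\<close>, then by Blichfeldt's theorem the open parallelepiped with edges
  \<open>\<beta>\<^sub>i (v\<^sub>i - v\<^bsub>d+1\<^esub>)\<close> contains \<open>k + 1\<close> points that are congruent modulo the lattice. Let \<open>y\<^sub>0\<close> be the one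
  whose coefficients have the largest sum. Then \<open>p + (y - y\<^sub>0)\<close> is an interior lattice point of the
  simplex for each of these points \<open>y\<close>: the first \<open>d\<close> coordinates stay positive because coefficients
  differ by less than \<open>\<beta>\<^sub>i\<close>, and the last one does not decrease. This gives \<open>k + 1\<close> of them.
\<close>

section \<open>Blichfeldt's theorem\<close>

lemma countable_lattice_points: "countable {z :: real^'n::finite. lattice_point z}"
proof -
  have "{z :: real^'n. lattice_point z} \<subseteq> (\<lambda>f. \<chi> i. of_int (f i)) ` (UNIV :: ('n \<Rightarrow> int) set)"
  proof
    fix z :: "real^'n" assume "z \<in> {z. lattice_point z}"
    then have "z = (\<chi> i. of_int \<lfloor>z $ i\<rfloor>)"
      by (simp add: lattice_point_def vec_eq_iff)
    then show "z \<in> (\<lambda>f. \<chi> i. of_int (f i)) ` (UNIV :: ('n \<Rightarrow> int) set)"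
      by (metis (mono_tags) rangeI)
  qed
  then show ?thesis by (rule countable_subset) simp
qed

text \<open>The integer translates of the half-open cube \<open>Q\<close> tile space. Moving all
  pieces of \<open>A\<close> into \<open>Q\<close> covers \<open>Q\<close> with average multiplicity
  equal to the volume of \<open>A\<close>, so some \<open>x\<close> lies in more than
  \<open>k\<close> moved pieces. The corresponding points \<open>x + z\<close> of \<open>A\<close>
  differ by lattice vectors.\<close>

theorem blichfeldt:
  fixes A :: "(real^'n::finite) set"
  assumes A [measurable]: "A \<in> sets borel" and big: "emeasure lborel A > of_nat k"
  obtains Y where "Y \<subseteq> A" "finite Y" "card Y = Suc k" "\<And>x y. x \<in> Y \<Longrightarrow> y \<in> Y \<Longrightarrow> lattice_point (x - y)"
proof -
  define L where "L = {z :: real^'n. lattice_point z}"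
  define Q where "Q = {x :: real^'n. \<forall>i. 0 \<le> x $ i \<and> x $ i < 1}"
  have L: "countable L" unfolding L_def by (rule countable_lattice_points)
  have Q [measurable]: "Q \<in> sets borel"
    unfolding Q_def by measurable
  have Q1: "emeasure lborel Q \<le> 1"
  proof -
    have "Q \<subseteq> cbox 0 1"
      by (auto simp: Q_def mem_box_cart less_imp_le)
    then have "emeasure lborel Q \<le> emeasure lborel (cbox 0 (1 :: real^'n))"
      by (rule emeasure_mono) simp
    also have "\<dots> = 1"
      by (subst emeasure_lborel_cbox)
        (auto simp: Basis_vec_def inner_axis prod.UNION_disjoint axis_eq_axis)
    finally show ?thesis .
  qed
  have floor_L: "(\<chi> i. of_int \<lfloor>x $ i\<rfloor>) \<in> L" for x :: "real^'n"
    by (simp add: L_def lattice_point_def)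
  have cover: "A = (\<Union>z\<in>L. A \<inter> {x. x - z \<in> Q})"
  proof (intro equalityI subsetI)
    fix x assume "x \<in> A"
    then show "x \<in> (\<Union>z\<in>L. A \<inter> {x. x - z \<in> Q})"
      using floor_L[of x]
      by (intro UN_I[of "\<chi> i. of_int \<lfloor>x $ i\<rfloor>"]) (auto simp: Q_def frac_lt_1 simp flip: frac_def)
  qed auto
  have disj: "disjoint_family_on (\<lambda>z. A \<inter> {x. x - z \<in> Q}) L"
  unfolding disjoint_family_on_def
  proof (intro ballI impI)
    fix z z' assume z: "z \<in> L" "z' \<in> L" "z \<noteq> z'"
    then obtain i where i: "z $ i \<noteq> z' $ i" by (auto simp: vec_eq_iff)
    obtain a b where ab: "z $ i = of_int a" "z' $ i = of_int b"
      using z by (auto simp: L_def lattice_point_def elim!: Ints_cases) (meson Ints_cases)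
    { fix x assume "x - z \<in> Q" "x - z' \<in> Q"
      then have "0 \<le> x $ i - of_int a" "x $ i - of_int a < 1" "0 \<le> x $ i - of_int b" "x $ i - of_int b < 1"
        unfolding Q_def by (simp_all flip: ab)
      then have "a = b" by linarith
      with i ab have False by simp }
    then show "A \<inter> {x. x - z \<in> Q} \<inter> (A \<inter> {x. x - z' \<in> Q}) = {}" by auto
  qed
  \<comment> \<open>Translation invariance moves the piece of \<open>A\<close> inside
    \<open>z + Q\<close> into \<open>Q\<close>.\<close>
  have trans: "emeasure lborel (A \<inter> {x. x - z \<in> Q})
      = (\<integral>\<^sup>+x. indicator {x. x + z \<in> A} x * indicator Q x \<partial>lborel)" for z
  proof -
    have "emeasure lborel (A \<inter> {x. x - z \<in> Q})
        = emeasure (distr lborel borel ((+) z)) (A \<inter> {x. x - z \<in> Q})"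
      by (simp add: lborel_distr_plus)
    also have "\<dots> = emeasure lborel ({x. x + z \<in> A} \<inter> Q)"
      by (subst emeasure_distr) (auto intro!: arg_cong[where f="emeasure lborel"] simp: add.commute)
    also have "\<dots> = (\<integral>\<^sup>+x. indicator ({x. x + z \<in> A} \<inter> Q) x \<partial>lborel)"
      by simp
    finally show ?thesis by (simp add: indicator_inter_arith)
  qed
  \<comment> \<open>Tonelli turns the sum of the volumes of the pieces into the integral over
    \<open>Q\<close> of the number of \<open>z\<close> in \<open>L\<close> with \<open>x + z\<close>
    in \<open>A\<close>.\<close>
  have "emeasure lborel A = (\<integral>\<^sup>+z. emeasure lborel (A \<inter> {x. x - z \<in> Q}) \<partial>count_space L)"
    by (subst cover, rule emeasure_UN_countable[OF _ L disj]) measurable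
  also have "\<dots> = (\<integral>\<^sup>+x. \<integral>\<^sup>+z. indicator {x. x + z \<in> A} x * indicator Q x \<partial>count_space L \<partial>lborel)"
    unfolding trans by (rule nn_integral_count_space_nn_integral[OF L, symmetric]) measurable
  also have "\<dots> = (\<integral>\<^sup>+x. emeasure (count_space L) {z \<in> L. x + z \<in> A} * indicator Q x \<partial>lborel)"
  proof (rule nn_integral_cong)
    fix x
    have "(\<integral>\<^sup>+z. indicator {x. x + z \<in> A} x * indicator Q x \<partial>count_space L)
        = (\<integral>\<^sup>+z. indicator {z \<in> L. x + z \<in> A} z \<partial>count_space L) * indicator Q x"
      by (subst nn_integral_multc[symmetric]) (auto intro!: nn_integral_cong simp: indicator_def)
    then show "(\<integral>\<^sup>+z. indicator {x. x + z \<in> A} x * indicator Q x \<partial>count_space L)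
        = emeasure (count_space L) {z \<in> L. x + z \<in> A} * indicator Q x"
      by simp
  qed
  finally have eq: "emeasure lborel A = \<dots>" .
  have "\<exists>x. \<not> emeasure (count_space L) {z \<in> L. x + z \<in> A} \<le> of_nat k"
  proof (rule ccontr)
    assume "\<not> ?thesis"
    then have "emeasure lborel A \<le> (\<integral>\<^sup>+x. of_nat k * indicator Q x \<partial>lborel)"
      unfolding eq by (intro nn_integral_mono mult_right_mono) auto
    also have "\<dots> = of_nat k * emeasure lborel Q"
      by (rule nn_integral_cmult_indicator) simp
    also have "\<dots> \<le> of_nat k * 1" by (intro mult_left_mono Q1) simp
    finally show False using big by simp
  qed
  then obtain x where x: "\<not> emeasure (count_space L) {z \<in> L. x + z \<in> A} \<le> of_nat k" ..
  \<comment> \<open>The number of such \<open>z\<close> may be infinite; then a finite subset of any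
    size exists.\<close>
  have "\<exists>Z. Z \<subseteq> {z \<in> L. x + z \<in> A} \<and> finite Z \<and> card Z = Suc k"
  proof (cases "finite {z \<in> L. x + z \<in> A}")
    case True
    with x have "Suc k \<le> card {z \<in> L. x + z \<in> A}"
      by (simp add: emeasure_count_space_finite)
    then show ?thesis by (rule obtain_subset_with_card_n) blast
  next
    case False
    then show ?thesis using infinite_arbitrarily_large by blast
  qed
  then obtain Z where Z: "Z \<subseteq> {z \<in> L. x + z \<in> A}" "finite Z" "card Z = Suc k" by blast
  show thesis
  proof (rule that[of "(+) x ` Z"])
    show "card ((+) x ` Z) = Suc k" using Z by (simp add: card_image)
    fix a b assume "a \<in> (+) x ` Z" "b \<in> (+) x ` Z"
    then show "lattice_point (a - b)" using Z(1)
      by (auto simp: L_def lattice_point_def subset_iff)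
  qed (use Z in auto)
qed

section \<open>Well-ordered index types\<close>

text \<open>Lebesgue measure is determined by its values on boxes, and renaming coordinates only
  permutes the side lengths of a box.\<close>

lemma lborel_distr_reindex:
  fixes f :: "'m::finite \<Rightarrow> 'n::finite"
  assumes "bij f"
  shows "distr lborel borel (\<lambda>x :: real^'n. \<chi> i. x $ f i) = lborel"
proof (rule lborel_eqI[symmetric])
  fix l u :: "real^'m"
  assume "\<And>b. b \<in> Basis \<Longrightarrow> l \<bullet> b \<le> u \<bullet> b"
  then have le: "l $ i \<le> u $ i" for i
    by (metis axis_in_Basis_iff cart_eq_inner_axis insert_iff Basis_real_def)
  have meas: "(\<lambda>x :: real^'n. \<chi> i. x $ f i) \<in> borel_measurable borel"
    by (intro borel_measurable_continuous_onI continuous_intros)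
  let ?g = "inv f"
  have fg: "f (?g j) = j" "?g (f i) = i" for i j
    using assms by (simp_all add: bij_is_surj surj_f_inv_f bij_is_inj)
  have pre: "(\<lambda>x :: real^'n. \<chi> i. x $ f i) -` box l u = box (\<chi> j. l $ ?g j) (\<chi> j. u $ ?g j)"
    by (auto simp: mem_box_cart fg) (metis fg)+
  have "emeasure (distr lborel borel (\<lambda>x :: real^'n. \<chi> i. x $ f i)) (box l u)
      = emeasure lborel (box (\<chi> j. l $ ?g j) (\<chi> j. u $ ?g j) :: (real^'n) set)"
    by (subst emeasure_distr) (use meas in \<open>auto simp: pre\<close>)
  also have "\<dots> = (\<Prod>b\<in>Basis. ((\<chi> j. u $ ?g j) - (\<chi> j. l $ ?g j) :: real^'n) \<bullet> b)"
    by (rule emeasure_lborel_box) (auto simp: Basis_vec_def inner_axis le)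
  also have "\<dots> = (\<Prod>j\<in>UNIV. u $ ?g j - l $ ?g j)"
    by (auto simp: Basis_vec_def inner_axis prod.UNION_disjoint axis_eq_axis)
  also have "\<dots> = (\<Prod>i\<in>UNIV. u $ i - l $ i)"
    by (subst prod.reindex_bij_betw[of ?g UNIV UNIV "\<lambda>i. u $ i - l $ i"]) (simp_all add: assms bij_imp_bij_inv)
  also have "\<dots> = (\<Prod>b\<in>Basis. (u - l) \<bullet> b)"
    by (auto simp: Basis_vec_def inner_axis prod.UNION_disjoint axis_eq_axis)
  finally show "emeasure (distr lborel borel (\<lambda>x :: real^'n. \<chi> i. x $ f i)) (box l u) = (\<Prod>b\<in>Basis. (u - l) \<bullet> b)" .
qed simp

text \<open>A well-ordered copy of a finite type: in HOL-Analysis, the volume formulas for linear images and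
  simplices in \<open>real^'n\<close> are only available for well-ordered index types.\<close>
typedef 'a ordered = "UNIV :: 'a::finite set" by simp

instance ordered :: (finite) finite
proof
  have "finite (range (Abs_ordered :: 'a \<Rightarrow> 'a ordered))" by simp
  then show "finite (UNIV :: 'a ordered set)"
    by (simp add: type_definition.Abs_image[OF type_definition_ordered])
qed

definition ordered_index :: "'a::finite ordered \<Rightarrow> nat" where
  "ordered_index = (SOME f. inj f)"

lemma inj_ordered_index: "inj ordered_index"
proof -
  have "\<exists>f :: 'a ordered \<Rightarrow> nat. inj f"
    using finite_imp_inj_to_nat_seg[of "UNIV :: 'a ordered set"] by auto
  then show ?thesis unfolding ordered_index_def by (rule someI_ex)
qed

instantiation ordered :: (finite) wellorder
begin

definition less_eq_ordered :: "'a ordered \<Rightarrow> 'a ordered \<Rightarrow> bool" where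
  "x \<le> y \<longleftrightarrow> ordered_index x \<le> ordered_index y"

definition less_ordered :: "'a ordered \<Rightarrow> 'a ordered \<Rightarrow> bool" where
  "x < y \<longleftrightarrow> ordered_index x < ordered_index y"

instance
proof
  fix P :: "'a ordered \<Rightarrow> bool" and a :: "'a ordered"
  assume step: "\<And>x. (\<And>y. y < x \<Longrightarrow> P y) \<Longrightarrow> P x"
  show "P a"
    by (induction a rule: measure_induct_rule[of ordered_index]) (auto simp: less_ordered_def intro: step)
qed (auto simp: less_eq_ordered_def less_ordered_def dest: injD[OF inj_ordered_index])

end

lemma bij_Rep_ordered: "bij Rep_ordered"
  by (rule o_bij[of Abs_ordered]) (auto simp: Abs_ordered_inverse Rep_ordered_inverse)

lemma CARD_ordered: "CARD('a::finite ordered) = CARD('a)"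
  using bij_Rep_ordered by (rule bij_betw_same_card)

text \<open>Renaming coordinates is a linear bijection preserving integrality and volume. This
  carries the volume bound from well-ordered index types to arbitrary finite ones.\<close>

lemma lattice_simplices_reindex:
  fixes S :: "(real^'n::finite) set" and f :: "'m::finite \<Rightarrow> 'n"
  assumes f: "bij f" and S: "S \<in> lattice_simplices TYPE('n) k"
  defines "R \<equiv> \<lambda>x :: real^'n. (\<chi> i. x $ f i) :: real^'m"
  shows "R ` S \<in> lattice_simplices TYPE('m) k" "measure lebesgue (R ` S) = measure lebesgue S"
proof -
  obtain V where V: "finite V" "card V = CARD('n) + 1" "\<not> affine_dependent V" "\<forall>v\<in>V. lattice_point v"
    "S = convex hull V" "card {x \<in> interior S. lattice_point x} = k"
    using S unfolding lattice_simplices_def by blast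
  have card: "CARD('m) = CARD('n)" using f by (rule bij_betw_same_card)
  have fg: "f (inv f j) = j" "inv f (f i) = i" for i j
    using f by (simp_all add: bij_is_surj surj_f_inv_f bij_is_inj)
  have lin: "linear R" unfolding R_def by (rule linearI) (auto simp: vec_eq_iff)
  have bij: "bij R"
    by (rule o_bij[of "\<lambda>y. \<chi> j. y $ inv f j"]) (auto simp: R_def vec_eq_iff fg)
  then have inj: "inj R" by (rule bij_is_inj)
  have lp: "lattice_point (R x) \<longleftrightarrow> lattice_point x" for x
  proof -
    have "(\<forall>i. x $ f i \<in> \<int>) \<longleftrightarrow> (\<forall>j\<in>range f. x $ j \<in> \<int>)" by simp
    then show ?thesis using f by (simp add: lattice_point_def R_def bij_is_surj)
  qed
  have "\<not> affine_dependent (R ` V)"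
  proof
    assume "affine_dependent (R ` V)"
    then obtain U where U: "sum U (R ` V) = 0" "\<exists>v\<in>R ` V. U v \<noteq> 0" "(\<Sum>v\<in>R ` V. U v *\<^sub>R v) = 0"
      using affine_dependent_explicit_finite[of "R ` V"] V(1) by auto
    have io: "inj_on R V" using inj by (rule inj_on_subset) simp
    have "R (\<Sum>v\<in>V. U (R v) *\<^sub>R v) = R 0"
      using U(3) io lin by (simp add: sum.reindex linear_sum linear_cmul linear_0)
    then have "(\<Sum>v\<in>V. U (R v) *\<^sub>R v) = 0" using inj by (simp add: inj_eq)
    moreover have "(\<Sum>v\<in>V. U (R v)) = 0" using U(1) io by (simp add: sum.reindex)
    ultimately have "affine_dependent V"
      unfolding affine_dependent_explicit_finite[OF V(1)] using U(2)
      by (intro exI[of _ "\<lambda>v. U (R v)"]) auto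
    then show False using V(3) by simp
  qed
  moreover have "R ` S = convex hull (R ` V)"
    using lin V(5) by (simp add: convex_hull_linear_image)
  moreover have "{x \<in> interior (R ` S). lattice_point x} = R ` {x \<in> interior S. lattice_point x}"
    using lin bij by (auto simp: interior_bijective_linear_image lp)
  then have "card {x \<in> interior (R ` S). lattice_point x} = k"
    using V(6) by (simp add: card_image inj_on_subset[OF inj])
  moreover have "card (R ` V) = CARD('m) + 1"
    using V(2) card by (simp add: card_image inj_on_subset[OF inj])
  ultimately show "R ` S \<in> lattice_simplices TYPE('m) k"
    unfolding lattice_simplices_def using V(1,4) lp
    by (intro CollectI exI[of _ "R ` V"]) auto
  have cS: "compact S" using V by (simp add: finite_imp_compact_convex_hull)
  then have "compact (R ` S)"
    using lin by (intro compact_continuous_image linear_continuous_on) (simp_all add: linear_conv_bounded_linear)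
  then have b: "S \<in> sets borel" "R ` S \<in> sets borel" using cS by (auto simp: compact_imp_closed)
  have "R \<in> borel_measurable borel"
    using lin by (intro borel_measurable_continuous_onI linear_continuous_on) (simp_all add: linear_conv_bounded_linear)
  then have "measure (distr lborel borel R) (R ` S) = measure lborel S"
    using b inj by (subst measure_distr) (auto simp: inj_vimage_image_eq)
  then show "measure lebesgue (R ` S) = measure lebesgue S"
    using b lborel_distr_reindex[OF f] by (simp add: R_def)
qed

section \<open>Simultaneous approximation\<close>

text \<open>The matrix determinant lemma. Multiples of \<open>v\<close> are added to the rows of the
  identity one row at a time; by multilinearity, row \<open>a\<close> contributes
  \<open>u $ a\<close> times a determinant whose row \<open>a\<close> is \<open>v\<close>.\<close>

lemma det_mat_plus_outer:
  fixes u v :: "real^'n"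
  shows "det (mat 1 + (\<chi> i j. u $ i * v $ j)) = 1 + u \<bullet> v"
proof -
  \<comment> \<open>The matrix factors into \<open>E\<close>, the identity with column
    \<open>a\<close> replaced by \<open>w\<close>, and \<open>F\<close>, the identity with row
    \<open>a\<close> replaced by \<open>v\<close>. Both determinants come from Cramer's
    lemma.\<close>
  have row_v: "det ((\<chi> i. if i = a then v else axis i 1 + (if i \<in> U then u $ i *s v else 0)) :: real^'n^'n) = v $ a"
    if "a \<notin> U" for a U
  proof -
    define w where "w = (\<chi> i. if i = a then 1 else if i \<in> U then u $ i else 0)"
    define E :: "real^'n^'n" where "E = (\<chi> i j. if j = a then (mat 1 *v w) $ i else mat 1 $ i $ j)"
    define F :: "real^'n^'n" where
      "F = (\<chi> i. if i = a then (\<Sum>i\<in>UNIV. v $ i *s row i (mat 1)) else row i (mat 1))"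
    have "det E = 1" unfolding E_def cramer_lemma by (simp add: w_def)
    moreover have "det F = v $ a" unfolding F_def cramer_lemma_transpose by simp
    moreover have Frow: "F $ l = (if l = a then v else axis l 1)" for l
      by (auto simp: F_def row_def mat_def vec_eq_iff axis_def if_distrib[of "\<lambda>x. _ * x"] cong: if_cong)
    have "E $ i $ l * F $ l $ j = (if l = a then w $ i * v $ j else 0)
        + (if l = i then if i = a then 0 else (axis i 1 :: real^'n) $ j else 0)" for i j l
      by (auto simp: Frow E_def) (auto simp: mat_def)
    then have "(E ** F) $ i $ j = (if i = a then v $ j else (axis i 1 :: real^'n) $ j + (if i \<in> U then u $ i * v $ j else 0))" for i j
      using that by (auto simp: matrix_matrix_mult_def w_def sum.distrib)
    then have "(\<chi> i. if i = a then v else axis i 1 + (if i \<in> U then u $ i *s v else 0)) = E ** F"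
      by (auto simp: vec_eq_iff)
    ultimately show ?thesis by (simp add: det_mul)
  qed
  have "det ((\<chi> i. axis i 1 + (if i \<in> U then u $ i *s v else 0)) :: real^'n^'n) = 1 + (\<Sum>i\<in>U. u $ i * v $ i)"
    if "finite U" for U
    using that
  proof induction
    case empty
    have "(\<chi> i. axis i 1 + 0) = (mat 1 :: real^'n^'n)"
      by (auto simp: vec_eq_iff axis_def mat_def)
    then show ?case by simp
  next
    case (insert a U)
    let ?c = "\<lambda>i. axis i 1 + (if i \<in> U then u $ i *s v else 0) :: real^'n"
    have "(\<chi> i. axis i 1 + (if i \<in> insert a U then u $ i *s v else 0))
        = (\<chi> i. if i = a then axis a 1 + u $ a *s v else ?c i)"
      by (auto simp: vec_eq_iff)
    also have "det \<dots> = det ((\<chi> i. if i = a then axis a 1 else ?c i) :: real^'n^'n)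
        + u $ a * det ((\<chi> i. if i = a then v else ?c i) :: real^'n^'n)"
      by (simp add: det_row_add[of a "\<lambda>_. axis a 1" "\<lambda>_. u $ a *s v" ?c] det_row_mul[of a _ "\<lambda>_. v" ?c])
    also have "(\<chi> i. if i = a then axis a 1 else ?c i) = (\<chi> i. ?c i)"
      using insert by (auto simp: vec_eq_iff)
    finally show ?case using insert row_v[of a U] by simp
  qed
  from this[of UNIV] have "det ((\<chi> i. axis i 1 + u $ i *s v) :: real^'n^'n) = 1 + u \<bullet> v"
    by (simp add: inner_vec_def)
  moreover have "mat 1 + (\<chi> i j. u $ i * v $ j) = (\<chi> i. axis i 1 + u $ i *s v)"
    by (auto simp: vec_eq_iff mat_def axis_def)
  ultimately show ?thesis by simp
qed

text \<open>Blichfeldt's theorem for the image of the box under \<open>F\<close>, pulled back along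
  this injective map. Differences of points in the box are bounded entrywise by \<open>c\<close>,
  which is what both the approximation and the counting argument exploit.\<close>

lemma box_points_with_lattice_differences:
  fixes F :: "real^('n::{finite,wellorder})^('n::_)" and c :: "real^('n::_)"
  assumes c: "\<And>i. 0 < c $ i" and big: "\<bar>det F\<bar> * (\<Prod>i\<in>UNIV. c $ i) > real k"
  obtains Y where "Y \<subseteq> box 0 c" "finite Y" "card Y = Suc k"
    "\<And>x y. x \<in> Y \<Longrightarrow> y \<in> Y \<Longrightarrow> lattice_point (F *v (x - y))"
proof -
  let ?A = "(*v) F ` box 0 c"
  have det: "det F \<noteq> 0" using big by auto
  then have inj: "inj ((*v) F)"
    by (simp add: inj_matrix_vector_mult invertible_det_nz)
  have lin: "linear ((*v) F)" by (rule matrix_vector_mul_linear)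
  have "open ?A" using lin inj by (simp add: open_bijective_linear_image_eq linear_injective_imp_surjective bijI open_box)
  then have borel: "?A \<in> sets borel" by simp
  have meas: "measure lebesgue (box 0 c) = (\<Prod>i\<in>UNIV. c $ i)"
    using c by (simp add: measure_lborel_box_eq Basis_vec_def inner_axis prod.UNION_disjoint axis_eq_axis less_imp_le)
  have A: "?A \<in> lmeasurable" "measure lebesgue ?A = \<bar>det F\<bar> * (\<Prod>i\<in>UNIV. c $ i)"
    using lin by (simp_all add: measurable_linear_image measure_linear_image meas)
  then have "emeasure lebesgue ?A = ennreal (\<bar>det F\<bar> * (\<Prod>i\<in>UNIV. c $ i))"
    by (simp add: emeasure_eq_measure2)
  then have "emeasure lborel ?A > of_nat k"
    using big borel by (simp add: ennreal_of_nat_eq_real_of_nat ennreal_less_iff)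
  then obtain Y where Y: "Y \<subseteq> ?A" "finite Y" "card Y = Suc k"
    "\<And>x y. x \<in> Y \<Longrightarrow> y \<in> Y \<Longrightarrow> lattice_point (x - y)"
    using blichfeldt[OF borel] by blast
  obtain X where X: "X \<subseteq> box 0 c" "Y = (*v) F ` X"
    using Y(1) by (meson subset_imageE)
  have injX: "inj_on ((*v) F) X" using inj by (rule inj_on_subset) simp
  show thesis
  proof (rule that[of X])
    show "finite X" using Y(2) X(2) injX by (simp add: finite_image_iff)
    show "card X = Suc k" using Y(3) X(2) injX by (simp add: card_image)
    show "lattice_point (F *v (x - y))" if "x \<in> X" "y \<in> X" for x y
      using Y(4) X(2) that by (simp add: matrix_vector_mult_diff_distrib)
  qed (rule X(1))
qed

text \<open>The errors \<open>z i - q * b i\<close>, where \<open>q = sum z T\<close>, depend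
  linearly on \<open>z\<close> with determinant \<open>1 - sum b T\<close>. The box with sides
  \<open>c i\<close> is larger than this, so it contains two points whose difference
  \<open>d\<close> is the error vector of an integral \<open>z\<close>.\<close>

lemma simultaneous_approximation:
  fixes T :: "'n::{finite,wellorder} set" and b c :: "'n \<Rightarrow> real"
  assumes c: "\<And>i. i \<in> T \<Longrightarrow> 0 < c i \<and> c i \<le> 1"
    and s: "sum b T < 1" and big: "prod c T > 1 - sum b T"
  obtains z :: "'n \<Rightarrow> int" where "sum z T \<ge> 1" "\<And>i. i \<in> T \<Longrightarrow> \<bar>of_int (sum z T) * b i - of_int (z i)\<bar> < c i"
proof -
  define s where "s = 1 - sum b T"
  have s0: "s > 0" using s by (simp add: s_def)
  define u v c' :: "real^('n::_)" where "u = (\<chi> i. if i \<in> T then b i / s else 0)"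
    and "v = (\<chi> i. if i \<in> T then 1 else 0)" and "c' = (\<chi> i. if i \<in> T then c i else 1)"
  \<comment> \<open>The inverse of the map subtracting \<open>(\<Sum>j\<in>T. z j) * b i\<close> from \<open>z i\<close> for \<open>i \<in> T\<close>. Outside \<open>T\<close> the box has
    side 1, so it does not affect the volume and forces integral differences to vanish there.\<close>
  define F where "F = mat 1 + (\<chi> i j. u $ i * v $ j)"
  have "u \<bullet> v = (\<Sum>i\<in>UNIV. if i \<in> T then b i / s else 0)"
    unfolding inner_vec_def by (rule sum.cong) (auto simp: u_def v_def)
  also have "\<dots> = sum b T / s"
    by (simp add: sum.If_cases sum_divide_distrib)
  finally have det: "det F = 1 / s"
    using s0 unfolding F_def det_mat_plus_outer by (simp add: s_def field_simps)
  have Fx: "(F *v x) $ i = x $ i + u $ i * (\<Sum>j\<in>T. x $ j)" for x i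
  proof -
    have "(F *v x) $ i = (\<Sum>j\<in>UNIV. (if j = i then x $ j else 0) + (if j \<in> T then u $ i * x $ j else 0))"
      unfolding matrix_vector_mult_def F_def
      by (auto simp: mat_def v_def algebra_simps intro!: sum.cong)
    also have "\<dots> = x $ i + u $ i * (\<Sum>j\<in>T. x $ j)"
      by (simp add: sum.distrib sum.If_cases sum_distrib_left)
    finally show ?thesis .
  qed
  have "(\<Prod>i\<in>UNIV. c' $ i) = prod c T"
    by (simp add: c'_def prod.If_cases)
  then have "\<bar>det F\<bar> * (\<Prod>i\<in>UNIV. c' $ i) > real 1"
    using s0 big by (simp add: det s_def field_simps)
  moreover have "0 < c' $ i" for i using c by (simp add: c'_def)
  ultimately obtain Y where Y: "Y \<subseteq> box 0 c'" "finite Y" "card Y = Suc 1"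
    "\<And>x y. x \<in> Y \<Longrightarrow> y \<in> Y \<Longrightarrow> lattice_point (F *v (x - y))"
    using box_points_with_lattice_differences[of c' 1 F] by blast
  \<comment> \<open>Ordering the two points by their coordinate sums over \<open>T\<close> makes
    \<open>q\<close> nonnegative.\<close>
  then obtain x y where xy: "x \<in> Y" "y \<in> Y" "x \<noteq> y" "(\<Sum>j\<in>T. y $ j) \<le> (\<Sum>j\<in>T. x $ j)"
    by (metis One_nat_def Suc_1 card_2_iff insertCI linorder_le_cases)
  define d where "d = x - y"
  have d0: "d \<noteq> 0" using xy by (simp add: d_def)
  have dc: "\<bar>d $ i\<bar> < c' $ i" for i
  proof -
    have "x \<in> box 0 c'" "y \<in> box 0 c'" using xy Y(1) by auto
    then have "0 < x $ i" "x $ i < c' $ i" "0 < y $ i" "y $ i < c' $ i" by (simp_all add: mem_box_cart)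
    then show ?thesis by (simp add: d_def)
  qed
  have sd: "(\<Sum>j\<in>T. d $ j) \<ge> 0" using xy by (simp add: d_def sum_subtractf)
  \<comment> \<open>The entries of \<open>F *v d\<close> are integral; the floor only converts them
    to type \<open>int\<close>.\<close>
  define z where "z i = \<lfloor>(F *v d) $ i\<rfloor>" for i
  have z: "of_int (z i) = d $ i + u $ i * (\<Sum>j\<in>T. d $ j)" for i
    using Y(4)[OF xy(1,2)] by (simp add: z_def lattice_point_def flip: Fx d_def)
  have "real_of_int (sum z T) = (\<Sum>i\<in>T. d $ i) + (\<Sum>i\<in>T. b i / s) * (\<Sum>j\<in>T. d $ j)"
    by (simp add: z sum.distrib sum_distrib_right u_def)
  also have "(\<Sum>i\<in>T. b i / s) = (1 - s) / s"
    by (simp add: s_def flip: sum_divide_distrib)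
  finally have q: "real_of_int (sum z T) = (\<Sum>i\<in>T. d $ i) / s"
    using s0 by (simp add: field_simps)
  have ubq: "u $ i * (\<Sum>j\<in>T. d $ j) = of_int (sum z T) * b i" if "i \<in> T" for i
    using that unfolding q by (simp add: u_def)
  \<comment> \<open>If the sum were 0, then \<open>d\<close> would equal the integral vector
    \<open>z\<close>. Its entries are below 1 in absolute value, so \<open>d\<close> would
    vanish.\<close>
  have "sum z T \<noteq> 0"
  proof
    assume "sum z T = 0"
    then have "(\<Sum>j\<in>T. d $ j) = 0" using q s0 by simp
    then have zd: "of_int (z i) = d $ i" for i using z[of i] by simp
    have "d $ i = 0" for i
    proof -
      have "\<bar>d $ i\<bar> < 1" using dc[of i] c[of i] by (auto simp: c'_def split: if_splits)
      then have "z i = 0" unfolding zd[symmetric] by linarith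
      then show ?thesis using zd[of i] by simp
    qed
    then show False using d0 by (simp add: vec_eq_iff)
  qed
  moreover have "real_of_int (sum z T) \<ge> 0" unfolding q using s0 sd by simp
  ultimately have "sum z T \<ge> 1" by linarith
  moreover have "\<bar>of_int (sum z T) * b i - of_int (z i)\<bar> < c i" if "i \<in> T" for i
    using dc[of i] z[of i] ubq[OF that] that by (simp add: c'_def)
  ultimately show thesis by (rule that)
qed

section \<open>Feasible vectors\<close>

lemma tau_feasible_antimono:
  assumes "tau_feasible d \<beta>" "1 \<le> i" "i \<le> j" "j \<le> d + 1"
  shows "\<beta> j \<le> \<beta> i"
  using assms(3,4)
proof (induction j rule: dec_induct)
  case (step n)
  then have "\<beta> (Suc n) \<le> \<beta> n" using assms(1,2) by (auto simp: tau_feasible_def)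
  then show ?case using step by simp
qed simp

text \<open>The bound is uniform in \<open>\<beta>\<close>, as positivity of an infimum requires. In
  the induction, either the last entry is already large, or the differences
  \<open>\<beta> i - \<beta> (d + 1)\<close> are large for all \<open>i\<close> up to
  \<open>Suc t\<close>, and the feasibility inequality at \<open>Suc t\<close> forces its right-hand
  side, hence the next entry, to be large.\<close>

lemma tau_feasible_lower_bound:
  assumes "t \<le> d"
  shows "\<exists>c>0. \<forall>\<beta>. tau_feasible d \<beta> \<longrightarrow> c \<le> \<beta> (Suc t)"
  using assms
proof (induction t)
  case 0
  have "1 / real (d + 1) \<le> \<beta> (Suc 0)" if "tau_feasible d \<beta>" for \<beta>
  proof -
    have "1 = (\<Sum>i=1..d+1. \<beta> i)" using that by (simp add: tau_feasible_def)
    also have "\<dots> \<le> real (card {1..d+1}) * \<beta> 1"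
      by (rule sum_bounded_above) (use that in \<open>auto intro: tau_feasible_antimono\<close>)
    finally show ?thesis by (simp add: field_simps)
  qed
  then show ?case by (intro exI[of _ "1 / real (d + 1)"]) auto
next
  case (Suc t)
  then obtain c where c: "c > 0" "\<And>\<beta>. tau_feasible d \<beta> \<Longrightarrow> c \<le> \<beta> (Suc t)" by auto
  \<comment> \<open>The two arguments of \<open>min\<close> serve the cases
    \<open>\<beta> (d + 1) > c / 2\<close> and \<open>\<beta> (d + 1) \<le> c / 2\<close>.\<close>
  let ?c = "min (c / 2) ((c / 2) ^ Suc t / real (d + 1))"
  have "?c \<le> \<beta> (Suc (Suc t))" if f: "tau_feasible d \<beta>" for \<beta>
  proof (cases "\<beta> (d + 1) \<le> c / 2")
    case False
    then show ?thesis
      using tau_feasible_antimono[OF f, of "Suc (Suc t)" "d + 1"] Suc.prems by auto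
  next
    case True
    have "c / 2 \<le> \<beta> i - \<beta> (d + 1)" if "i \<in> {1..Suc t}" for i
      using tau_feasible_antimono[OF f, of i "Suc t"] c(2)[OF f] that True Suc.prems by auto
    then have "(\<Prod>i\<in>{1..Suc t}. c / 2) \<le> (\<Prod>i=1..Suc t. \<beta> i - \<beta> (d + 1))"
      using c(1) by (intro prod_mono) auto
    also have "\<dots> \<le> (\<Sum>j=Suc t+1..d+1. \<beta> j - \<beta> (d+1)) + real (d+1) * \<beta> (d+1)"
      using f[unfolded tau_feasible_def, THEN conjunct2, THEN conjunct2, THEN conjunct2]
      by (rule bspec) (use Suc.prems in auto)
    \<comment> \<open>The tail has \<open>d - t\<close> entries, so \<open>Suc t\<close> of the
      \<open>d + 1\<close> copies of \<open>\<beta> (d + 1)\<close> remain.\<close>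
    also have "\<dots> = (\<Sum>j=Suc t+1..d+1. \<beta> j) + real (Suc t) * \<beta> (d+1)"
      using Suc.prems by (simp add: sum_subtractf algebra_simps of_nat_diff)
    also have "\<dots> \<le> real (card {Suc t+1..d+1}) * \<beta> (Suc t+1) + real (Suc t) * \<beta> (Suc t+1)"
    proof (intro add_mono sum_bounded_above mult_left_mono)
      show "\<beta> j \<le> \<beta> (Suc t+1)" if "j \<in> {Suc t+1..d+1}" for j
        using that by (intro tau_feasible_antimono[OF f]) auto
      show "\<beta> (d+1) \<le> \<beta> (Suc t+1)"
        using Suc.prems by (intro tau_feasible_antimono[OF f]) auto
    qed simp
    also have "\<dots> = real (d + 1) * \<beta> (Suc (Suc t))"
      using Suc.prems by (simp add: algebra_simps of_nat_diff)
    finally have "(c / 2) ^ Suc t / real (d + 1) \<le> \<beta> (Suc (Suc t))"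
      by (simp add: divide_le_eq algebra_simps)
    then show ?thesis by simp
  qed
  moreover have "?c > 0" using c(1) by simp
  ultimately show ?case by (intro exI[of _ ?c]) auto
qed

text \<open>Shows that the infimum defining \<open>tau\<close> is over a nonempty set. All
  differences are 0, so the products vanish because \<open>t \<ge> 1\<close>.\<close>

lemma tau_feasible_const: "tau_feasible d (\<lambda>_. 1 / real (d + 1))"
  by (auto simp: tau_feasible_def power_0_left)

lemma tau_pos: "tau d > 0"
proof -
  obtain c where c: "c > 0" "\<And>\<beta>. tau_feasible d \<beta> \<Longrightarrow> c \<le> \<beta> (Suc d)"
    using tau_feasible_lower_bound[of d d] by auto
  have "c ^ d \<le> tau d"
    unfolding tau_def
  proof (rule cInf_greatest)
    show "(\<lambda>\<beta>. \<Prod>i=1..d. \<beta> i) ` {\<beta>. tau_feasible d \<beta>} \<noteq> {}" using tau_feasible_const by auto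
    fix x assume "x \<in> (\<lambda>\<beta>. \<Prod>i=1..d. \<beta> i) ` {\<beta>. tau_feasible d \<beta>}"
    then obtain \<beta> where \<beta>: "tau_feasible d \<beta>" "x = (\<Prod>i=1..d. \<beta> i)" by auto
    have "c \<le> \<beta> i" if "i \<in> {1..d}" for i
      using c(2)[OF \<beta>(1)] tau_feasible_antimono[OF \<beta>(1), of i "Suc d"] that by auto
    then have "(\<Prod>i=1..d. c) \<le> x" unfolding \<beta>(2) using c(1) by (intro prod_mono) auto
    then show "c ^ d \<le> x" by simp
  qed
  moreover have "c ^ d > 0" using c(1) by simp
  ultimately show ?thesis by linarith
qed

lemma tau_le:
  assumes "tau_feasible d \<beta>"
  shows "tau d \<le> (\<Prod>i=1..d. \<beta> i)"
  unfolding tau_def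
proof (rule cInf_lower)
  have "0 \<le> (\<Prod>i=1..d. \<gamma> i)" if f: "tau_feasible d \<gamma>" for \<gamma>
  proof (rule prod_nonneg)
    fix i assume "i \<in> {1..d}"
    then have "\<gamma> (d + 1) \<le> \<gamma> i" using f by (intro tau_feasible_antimono) auto
    then show "0 \<le> \<gamma> i" using f by (simp add: tau_feasible_def)
  qed
  then show "bdd_below ((\<lambda>\<beta>. \<Prod>i=1..d. \<beta> i) ` {\<beta>. tau_feasible d \<beta>})"
    by (intro bdd_belowI[of _ 0]) auto
qed (use assms in auto)

section \<open>Lattice simplices\<close>

text \<open>Barycentric coordinate vectors of the interior lattice points when \<open>V\<close>
  spans a full-dimensional simplex. Extensionality fixes the values outside \<open>V\<close>, so
  that each point has exactly one such function.\<close>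

definition interior_coords :: "(real^'n) set \<Rightarrow> (real^'n \<Rightarrow> real) set" where
  "interior_coords V = {u \<in> extensional V. (\<forall>v\<in>V. 0 < u v) \<and> sum u V = 1 \<and> lattice_point (\<Sum>v\<in>V. u v *\<^sub>R v)}"

text \<open>Affine independence makes coordinates unique. Full dimension makes the interior consist
  of the points with positive coordinates.\<close>

lemma bij_betw_interior_coords:
  fixes V :: "(real^'n::finite) set"
  assumes V: "finite V" "card V = CARD('n) + 1" "\<not> affine_dependent V"
  shows "bij_betw (\<lambda>u. \<Sum>v\<in>V. u v *\<^sub>R v) (interior_coords V) {x \<in> interior (convex hull V). lattice_point x}"
  unfolding bij_betw_def
proof
  show "inj_on (\<lambda>u. \<Sum>v\<in>V. u v *\<^sub>R v) (interior_coords V)"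
  proof (rule inj_onI)
    fix u u' assume u: "u \<in> interior_coords V" "u' \<in> interior_coords V"
      and eq: "(\<Sum>v\<in>V. u v *\<^sub>R v) = (\<Sum>v\<in>V. u' v *\<^sub>R v)"
    have "(\<Sum>v\<in>V. u v - u' v) = 0" "(\<Sum>v\<in>V. (u v - u' v) *\<^sub>R v) = 0"
      using u eq by (simp_all add: interior_coords_def sum_subtractf scaleR_diff_left)
    then have "\<forall>v\<in>V. u v - u' v = 0"
      using V(3) unfolding affine_dependent_explicit_finite[OF V(1)] by meson
    then show "u = u'"
      using u by (intro extensionalityI[of u V]) (auto simp: interior_coords_def)
  qed
  have int: "interior (convex hull V) = {y. \<exists>u. (\<forall>x\<in>V. 0 < u x) \<and> sum u V = 1 \<and> (\<Sum>x\<in>V. u x *\<^sub>R x) = y}"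
    using V by (simp add: interior_convex_hull_explicit_minimal)
  show "(\<lambda>u. \<Sum>v\<in>V. u v *\<^sub>R v) ` interior_coords V = {x \<in> interior (convex hull V). lattice_point x}"
  proof (intro equalityI subsetI)
    fix x assume "x \<in> {x \<in> interior (convex hull V). lattice_point x}"
    then obtain u where u: "\<forall>v\<in>V. 0 < u v" "sum u V = 1" "(\<Sum>v\<in>V. u v *\<^sub>R v) = x" "lattice_point x"
      unfolding int by auto
    then have "restrict u V \<in> interior_coords V" "x = (\<Sum>v\<in>V. restrict u V v *\<^sub>R v)"
      by (simp_all add: interior_coords_def)
    then show "x \<in> (\<lambda>u. \<Sum>v\<in>V. u v *\<^sub>R v) ` interior_coords V" by blast
  qed (auto simp: interior_coords_def int)
qed

lemma sum_split_vertex: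
  fixes g :: "'n::finite \<Rightarrow> 'a"
  assumes "finite V" "w \<in> V" "bij_betw g UNIV (V - {w})"
  shows "sum f V = f w + (\<Sum>i\<in>UNIV. f (g i))"
  using assms by (simp add: sum.remove[of V w] sum.reindex_bij_betw)

lemma lattice_point_add: "lattice_point x \<Longrightarrow> lattice_point y \<Longrightarrow> lattice_point (x + y)"
  and lattice_point_diff: "lattice_point x \<Longrightarrow> lattice_point y \<Longrightarrow> lattice_point (x - y)"
  and lattice_point_scale: "lattice_point x \<Longrightarrow> lattice_point (of_int a *\<^sub>R x)"
  and lattice_point_sum: "(\<And>i. i \<in> I \<Longrightarrow> lattice_point (f i)) \<Longrightarrow> lattice_point (sum f I)"
  by (auto simp: lattice_point_def)

text \<open>The counting argument: the columns of \<open>M\<close> are the edges from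
  \<open>w\<close>, so \<open>\<bar>det M\<bar>\<close> is the normalized volume. A product above
  \<open>k\<close> would yield \<open>k + 1\<close> distinct interior lattice points.\<close>

lemma content_simplex_times_coords_le:
  fixes V :: "(real^('n::{finite,wellorder})) set" and g :: "'n \<Rightarrow> real^('n::_)"
  assumes V: "finite V" "card V = CARD('n) + 1" "\<not> affine_dependent V"
    and fin: "finite (interior_coords V)" and u: "u \<in> interior_coords V"
    and w: "w \<in> V" and g: "bij_betw g UNIV (V - {w})"
  shows "measure lebesgue (convex hull V) * fact CARD('n) * (\<Prod>i\<in>UNIV. u (g i)) \<le> real (card (interior_coords V))"
proof -
  define M :: "real^('n::_)^('n::_)" where "M = (\<chi> i j. g j $ i - w $ i)"
  define k where "k = card (interior_coords V)"
  define \<beta> :: "real^('n::_)" where "\<beta> = (\<chi> i. u (g i))"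
  have gV: "g i \<in> V" "g i \<noteq> w" for i using g by (auto simp: bij_betw_def)
  have inv: "the_inv g (g i) = i" for i using g by (intro the_inv_f_f) (auto simp: bij_betw_def)
  have upos: "0 < u v" if "v \<in> V" for v using u that by (simp add: interior_coords_def)
  have "measure lebesgue (convex hull V) = measure lborel (convex hull V)"
    using V(1) by (simp add: measure_completion finite_imp_compact_convex_hull compact_imp_closed)
  then have vol: "measure lebesgue (convex hull V) * fact CARD('n) = \<bar>det M\<bar>"
    using content_simplex[OF V(1) _ w g] V(2) by (simp add: M_def)
  have "\<not> real k < \<bar>det M\<bar> * (\<Prod>i\<in>UNIV. \<beta> $ i)"
  proof
    assume "real k < \<bar>det M\<bar> * (\<Prod>i\<in>UNIV. \<beta> $ i)"
    then obtain Y where Y: "Y \<subseteq> box 0 \<beta>" "finite Y" "card Y = Suc k"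
      "\<And>x y. x \<in> Y \<Longrightarrow> y \<in> Y \<Longrightarrow> lattice_point (M *v (x - y))"
      using box_points_with_lattice_differences[of \<beta> k M] upos gV by (auto simp: \<beta>_def)
    have "Y \<noteq> {}" using Y(3) by auto
    define m where "m = Max ((\<lambda>y. \<Sum>i\<in>UNIV. y $ i) ` Y)"
    have "m \<in> (\<lambda>y. \<Sum>i\<in>UNIV. y $ i) ` Y"
      unfolding m_def using Y(2) \<open>Y \<noteq> {}\<close> by (intro Max_in) auto
    then obtain y0 where y0: "y0 \<in> Y" "m = (\<Sum>i\<in>UNIV. y0 $ i)" by auto
    have top: "(\<Sum>i\<in>UNIV. y $ i) \<le> (\<Sum>i\<in>UNIV. y0 $ i)" if "y \<in> Y" for y
      using that Y(2) by (simp add: m_def flip: y0(2))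
    \<comment> \<open>Coordinates of the interior lattice point of \<open>u\<close> shifted by
      \<open>M *v (y - y0)\<close>: vertex \<open>g i\<close> gains entry \<open>i\<close> of
      \<open>y - y0\<close>, and \<open>w\<close> loses their sum.\<close>
    define h where "h y = (\<lambda>v\<in>V. if v = w then u w - (\<Sum>i\<in>UNIV. (y - y0) $ i)
        else u v + (y - y0) $ the_inv g v)" for y
    have hw: "h y w = u w - (\<Sum>i\<in>UNIV. (y - y0) $ i)" for y using w by (simp add: h_def)
    have hg: "h y (g i) = u (g i) + (y - y0) $ i" for y i using gV by (simp add: h_def inv)
    have "h y \<in> interior_coords V" if y: "y \<in> Y" for y
      unfolding interior_coords_def
    proof (intro CollectI conjI ballI)
      show "h y \<in> extensional V" by (simp add: h_def)
      show "sum (h y) V = 1"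
        using u sum_split_vertex[OF V(1) w g, of u]
        by (simp add: sum_split_vertex[OF V(1) w g] hw hg sum.distrib interior_coords_def)
      have "(\<Sum>v\<in>V. h y v *\<^sub>R v)
          = (\<Sum>v\<in>V. u v *\<^sub>R v) + (\<Sum>i\<in>UNIV. (y - y0) $ i *\<^sub>R (g i - w))"
        by (simp only: sum_split_vertex[OF V(1) w g] hw hg scaleR_add_left scaleR_diff_left
            scaleR_diff_right sum.distrib sum_subtractf flip: scaleR_left.sum) simp
      also have "(\<Sum>i\<in>UNIV. (y - y0) $ i *\<^sub>R (g i - w)) = M *v (y - y0)"
        by (simp add: vec_eq_iff matrix_vector_mult_def M_def mult.commute)
      finally show "lattice_point (\<Sum>v\<in>V. h y v *\<^sub>R v)"
        using u Y(4)[OF y y0(1)] by (simp add: interior_coords_def lattice_point_add)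
    next
      fix v assume v: "v \<in> V"
      show "0 < h y v"
      proof (cases "v = w")
        case True
        then show ?thesis using hw[of y] top[OF y] upos[OF w] by (simp add: sum_subtractf)
      next
        case False
        with v g obtain i where i: "v = g i" by (auto simp: bij_betw_def)
        \<comment> \<open>Here \<open>u (g i) - y0 $ i\<close> and \<open>y $ i\<close> are both
          positive, and the new coordinate is their sum.\<close>
        have "y \<in> box 0 \<beta>" "y0 \<in> box 0 \<beta>" using Y(1) y y0(1) by auto
        then have "0 < y $ i" "y0 $ i < u (g i)" by (simp_all add: mem_box_cart \<beta>_def)
        then show ?thesis by (simp add: i hg)
      qed
    qed
    then have "h ` Y \<subseteq> interior_coords V" by auto
    moreover have "inj_on h Y"
    proof (rule inj_onI)
      fix x y assume "h x = h y"
      then have "h x (g i) = h y (g i)" for i by simp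
      then show "x = y" by (simp add: hg vec_eq_iff)
    qed
    ultimately have "Suc k \<le> card (interior_coords V)"
      using card_inj_on_le[OF _ _ fin] Y(3) by metis
    then show False by (simp add: k_def)
  qed
  then show ?thesis by (simp add: vol \<beta>_def k_def)
qed

text \<open>If the inequality failed, simultaneous approximation of the coordinates on
  \<open>T\<close> would produce an interior lattice point all of whose coordinates exceed
  \<open>u w\<close>, contradicting the maximality of this depth.\<close>

lemma prod_coords_le_of_max_min_coord:
  fixes V :: "(real^('n::{finite,wellorder})) set"
  assumes V: "finite V" "card V = CARD('n) + 1" and lat: "\<And>v. v \<in> V \<Longrightarrow> lattice_point v"
    and u: "u \<in> interior_coords V" and w: "w \<in> V" and min: "\<And>v. v \<in> V \<Longrightarrow> u w \<le> u v"
    and max: "\<And>u'. u' \<in> interior_coords V \<Longrightarrow> \<exists>v\<in>V. u' v \<le> u w"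
    and T: "T \<subseteq> V - {w}"
  shows "(\<Prod>v\<in>T. u v - u w) \<le> 1 - sum u T"
proof (rule ccontr)
  assume "\<not> ?thesis"
  then have big: "(\<Prod>v\<in>T. u v - u w) > 1 - sum u T" by simp
  have upos: "0 < u v" if "v \<in> V" for v using u that by (simp add: interior_coords_def)
  have usum: "sum u V = 1" using u by (simp add: interior_coords_def)
  have finT: "finite T" using T V(1) finite_subset by blast
  have "sum u (insert w T) \<le> sum u V"
    using T w V(1) upos by (intro sum_mono2) (auto intro: less_imp_le)
  moreover have "w \<notin> T" using T by auto
  ultimately have sT: "sum u T < 1" using upos[OF w] usum finT by simp
  have u1: "u v \<le> 1" if "v \<in> V" for v
    using member_le_sum[of v V u] that upos V(1) usum by (auto intro: less_imp_le)
  \<comment> \<open>A zero factor would make the product 0, while \<open>1 - sum u T\<close> is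
    positive because \<open>w\<close> lies outside \<open>T\<close>.\<close>
  have pos: "u v - u w > 0" if "v \<in> T" for v
  proof (rule ccontr)
    assume "\<not> u v - u w > 0"
    then have "u v - u w = 0" using min[of v] T that by auto
    then have "(\<Prod>v\<in>T. u v - u w) = 0" using that finT by auto
    then show False using big sT by simp
  qed
  have "card (V - {w}) = CARD('n)" using V w by simp
  then obtain g :: "'n \<Rightarrow> real^('n::_)" where g: "bij_betw g UNIV (V - {w})"
    using finite_same_card_bij[of "UNIV :: 'n set" "V - {w}"] V(1) by auto
  have inj: "inj_on g A" for A using g by (auto simp: bij_betw_def intro: inj_on_subset)
  define I where "I = g -` T"
  have gI: "g ` I = T" using g T by (auto simp: I_def bij_betw_def)
  have sumI: "sum f T = (\<Sum>i\<in>I. f (g i))" for f :: "real^('n::_) \<Rightarrow> real"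
    unfolding gI[symmetric] by (simp add: sum.reindex inj)
  have "prod (\<lambda>i. u (g i) - u w) I > 1 - sum (\<lambda>i. u (g i)) I"
    using big unfolding gI[symmetric] by (simp add: sum.reindex prod.reindex inj)
  moreover have "sum (\<lambda>i. u (g i)) I < 1" using sT by (simp add: sumI)
  moreover have "0 < u (g i) - u w \<and> u (g i) - u w \<le> 1" if "i \<in> I" for i
    using pos[of "g i"] u1[of "g i"] upos[OF w] that T by (auto simp: I_def)
  ultimately obtain z :: "'n \<Rightarrow> int" where z: "sum z I \<ge> 1"
    "\<And>i. i \<in> I \<Longrightarrow> \<bar>of_int (sum z I) * u (g i) - of_int (z i)\<bar> < u (g i) - u w"
    using simultaneous_approximation[of I "\<lambda>i. u (g i) - u w" "\<lambda>i. u (g i)"] by blast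
  define q where "q = sum z I"
  \<comment> \<open>Extending \<open>z\<close> by 0 to all vertices keeps the sum equal to
    \<open>q\<close>.\<close>
  define \<zeta> where "\<zeta> v = (if v \<in> T then z (the_inv g v) else 0)" for v
  have \<zeta>g: "\<zeta> (g i) = z i" if "i \<in> I" for i
    using that by (simp add: \<zeta>_def I_def the_inv_f_f inj)
  have \<zeta>sum: "(\<Sum>v\<in>V. \<zeta> v) = q"
  proof -
    have "(\<Sum>v\<in>V. \<zeta> v) = (\<Sum>v\<in>T. \<zeta> v)"
      using T V(1) by (intro sum.mono_neutral_right) (auto simp: \<zeta>_def)
    also have "\<dots> = q" unfolding gI[symmetric] q_def by (simp add: sum.reindex inj \<zeta>g)
    finally show ?thesis .
  qed
  \<comment> \<open>The coordinates sum to \<open>(q + 1) - q = 1\<close>, and the point is an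
    integral combination of lattice points. On \<open>T\<close> the approximation error is less than
    \<open>u v - u w\<close>; off \<open>T\<close> the coordinate is at least
    \<open>2 * u v\<close>.\<close>
  define u' where "u' = (\<lambda>v\<in>V. of_int (q + 1) * u v - of_int (\<zeta> v))"
  have large: "u w < u' v" if v: "v \<in> V" for v
  proof (cases "v \<in> T")
    case True
    then obtain i where i: "i \<in> I" "v = g i" using gI by auto
    have "u' v = u v + (of_int q * u (g i) - of_int (z i))"
      using v \<zeta>g[OF i(1)] by (simp add: u'_def i(2) algebra_simps)
    then show ?thesis using z(2)[OF i(1)] by (simp add: q_def i(2))
  next
    case False
    have "1 * u v \<le> of_int q * u v"
      using z(1)[folded q_def] upos[OF v] by (intro mult_right_mono) simp_all
    moreover have "u' v = of_int q * u v + u v" using v False by (simp add: u'_def \<zeta>_def algebra_simps)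
    ultimately show ?thesis using upos[OF v] min[OF v] by linarith
  qed
  have "u' \<in> interior_coords V"
    unfolding interior_coords_def
  proof (intro CollectI conjI ballI)
    show "u' \<in> extensional V" by (simp add: u'_def)
    show "0 < u' v" if "v \<in> V" for v using large[OF that] upos[OF w] by simp
    have "sum u' V = of_int (q + 1) * sum u V - of_int (\<Sum>v\<in>V. \<zeta> v)"
      by (simp add: u'_def sum_subtractf sum_distrib_left)
    then show "sum u' V = 1" by (simp add: usum \<zeta>sum)
    have "(\<Sum>v\<in>V. u' v *\<^sub>R v)
        = of_int (q + 1) *\<^sub>R (\<Sum>v\<in>V. u v *\<^sub>R v) - (\<Sum>v\<in>V. of_int (\<zeta> v) *\<^sub>R v)"
      unfolding scaleR_sum_right sum_subtractf[symmetric]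
      by (rule sum.cong) (simp_all add: u'_def scaleR_diff_left)
    also have "lattice_point \<dots>"
    proof (intro lattice_point_diff lattice_point_scale)
      show "lattice_point (\<Sum>v\<in>V. u v *\<^sub>R v)" using u by (simp add: interior_coords_def)
      show "lattice_point (\<Sum>v\<in>V. of_int (\<zeta> v) *\<^sub>R v)"
        using lat by (intro lattice_point_sum lattice_point_scale)
    qed
    finally show "lattice_point (\<Sum>v\<in>V. u' v *\<^sub>R v)" .
  qed
  then obtain v where "v \<in> V" "u' v \<le> u w" using max by blast
  then show False using large by fastforce
qed

lemma ex_antimono_enumeration:
  fixes u :: "'a \<Rightarrow> real"
  assumes "finite V" "card V = n"
  obtains e where "bij_betw e {1..n} V" "\<And>i j. 1 \<le> i \<Longrightarrow> i \<le> j \<Longrightarrow> j \<le> n \<Longrightarrow> u (e j) \<le> u (e i)"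
proof -
  obtain ys where ys: "set ys = V" "distinct ys" using assms(1) finite_distinct_list by blast
  define xs where "xs = sort_key (\<lambda>v. - u v) ys"
  \<comment> \<open>Sorting by \<open>- u v\<close> lists the vertices by decreasing
    \<open>u\<close>.\<close>
  have xs: "set xs = V" "distinct xs" "sorted (map (\<lambda>v. - u v) xs)" "length xs = n"
    using ys assms(2) by (auto simp: xs_def distinct_card)
  have "bij_betw (\<lambda>i. i - 1) {1..n} {..<n}"
    by (rule bij_betw_byWitness[of _ Suc]) auto
  moreover have "bij_betw ((!) xs) {..<n} V"
    using xs by (intro bij_betw_nth) auto
  ultimately have "bij_betw (\<lambda>i. xs ! (i - 1)) {1..n} V"
    using bij_betw_trans[of "\<lambda>i. i - 1" _ _ "(!) xs"] by (simp add: o_def)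
  moreover have "u (xs ! (j - 1)) \<le> u (xs ! (i - 1))" if "1 \<le> i" "i \<le> j" "j \<le> n" for i j
    using sorted_nth_mono[OF xs(3), of "i - 1" "j - 1"] that xs(4) by simp
  ultimately show thesis by (rule that)
qed

text \<open>Combines the two estimates for a deepest interior lattice point: its ordered coordinates
  are feasible, so their product without the smallest one is at least \<open>tau\<close>.\<close>

lemma lattice_simplex_content_le:
  fixes S :: "(real^('n::{finite,wellorder})) set"
  assumes k: "k \<ge> 1" and S: "S \<in> lattice_simplices TYPE('n) k"
  shows "measure lebesgue S \<le> real k / (fact CARD('n) * tau CARD('n))"
proof -
  define d where "d = CARD('n)"
  obtain V where V: "finite V" "card V = CARD('n) + 1" "\<not> affine_dependent V" "\<forall>v\<in>V. lattice_point v"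
    "S = convex hull V" "card {x \<in> interior S. lattice_point x} = k"
    using S unfolding lattice_simplices_def by blast
  let ?P = "interior_coords V"
  have cardP: "card ?P = k"
    using bij_betw_same_card[OF bij_betw_interior_coords[OF V(1-3)]] V(5,6) by simp
  \<comment> \<open>Since \<open>card\<close> is 0 on infinite sets, \<open>k \<ge> 1\<close> gives
    finiteness as well as nonemptiness.\<close>
  then have finP: "finite ?P" "?P \<noteq> {}" using k by (auto intro: card_ge_0_finite)
  have "V \<noteq> {}" using V(2) by auto
  define m where "m = Max ((\<lambda>u. Min (u ` V)) ` ?P)"
  have "m \<in> (\<lambda>u. Min (u ` V)) ` ?P" unfolding m_def using finP by (intro Max_in) auto
  then obtain u where u: "u \<in> ?P" "m = Min (u ` V)" by auto
  have mtop: "Min (u' ` V) \<le> Min (u ` V)" if "u' \<in> ?P" for u'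
    using that finP by (simp add: m_def flip: u(2))
  have upos: "0 < u v" if "v \<in> V" for v using u(1) that by (simp add: interior_coords_def)
  obtain e where e: "bij_betw e {1..d+1} V"
    and mono: "\<And>i j. 1 \<le> i \<Longrightarrow> i \<le> j \<Longrightarrow> j \<le> d+1 \<Longrightarrow> u (e j) \<le> u (e i)"
    using ex_antimono_enumeration[OF V(1), of "d+1" u] V(2) by (auto simp: d_def)
  define w where "w = e (d+1)"
  have eV: "e i \<in> V" if "i \<in> {1..d+1}" for i using e that by (auto simp: bij_betw_def)
  have inje: "inj_on e {1..d+1}" using e by (simp add: bij_betw_def)
  have w: "w \<in> V" using eV by (simp add: w_def)
  have min: "u w \<le> u v" if v: "v \<in> V" for v
  proof -
    obtain i where "i \<in> {1..d+1}" "v = e i" using e v unfolding bij_betw_def by blast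
    then show ?thesis using mono[of i "d+1"] by (simp add: w_def)
  qed
  have Minw: "Min (u ` V) = u w" using V(1) w min by (intro Min_eqI) auto
  have max: "\<exists>v\<in>V. u' v \<le> u w" if "u' \<in> ?P" for u'
  proof -
    have "Min (u' ` V) \<in> u' ` V" using V(1) \<open>V \<noteq> {}\<close> by (intro Min_in) auto
    then show ?thesis using mtop[OF that] Minw by auto
  qed
  define \<beta> where "\<beta> i = u (e i)" for i
  have sum1: "(\<Sum>i=1..d+1. \<beta> i) = 1"
    using u(1) sum.reindex_bij_betw[OF e, of u] by (simp add: \<beta>_def interior_coords_def)
  have "tau_feasible d \<beta>"
    unfolding tau_feasible_def
  proof (intro conjI ballI)
    show "\<beta> (Suc i) \<le> \<beta> i" if "i \<in> {1..d}" for i using mono[of i "Suc i"] that by (simp add: \<beta>_def)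
    show "0 \<le> \<beta> (d+1)" using upos[OF w] by (simp add: \<beta>_def w_def)
    show "(\<Sum>i=1..d+1. \<beta> i) = 1" by (rule sum1)
    fix t assume t: "t \<in> {1..d}"
    have inj: "inj_on e {1..t}" using inje t by (auto intro: inj_on_subset)
    have "e ` {1..t} \<subseteq> V - {w}"
    proof
      fix v assume "v \<in> e ` {1..t}"
      then obtain i where i: "i \<in> {1..t}" "v = e i" by auto
      then have "e i \<noteq> e (d+1)" using inje t by (subst inj_on_eq_iff[OF inje]) auto
      then show "v \<in> V - {w}" using eV[of i] i t by (auto simp: w_def)
    qed
    from prod_coords_le_of_max_min_coord[OF V(1,2) _ u(1) w min max this] V(4)
    have "(\<Prod>i=1..t. \<beta> i - \<beta> (d+1)) \<le> 1 - (\<Sum>i=1..t. \<beta> i)"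
      using inj by (simp add: prod.reindex sum.reindex \<beta>_def w_def)
    also have "\<dots> = (\<Sum>j=t+1..d+1. \<beta> j)"
    proof -
      have "{1..d+1} = {1..t} \<union> {t+1..d+1}" using t by auto
      moreover have "sum \<beta> ({1..t} \<union> {t+1..d+1}) = sum \<beta> {1..t} + sum \<beta> {t+1..d+1}"
        by (rule sum.union_disjoint) auto
      ultimately show ?thesis using sum1 by simp
    qed
    also have "\<dots> = (\<Sum>j=t+1..d+1. \<beta> j - \<beta> (d+1)) + real (card {t+1..d+1}) * \<beta> (d+1)"
      by (simp only: sum_subtractf sum_constant)
    \<comment> \<open>The tail accounts for only \<open>d + 1 - t\<close> copies of
      \<open>\<beta> (d + 1)\<close>; rounding up to \<open>d + 1\<close> gives the inequality of
      \<open>tau_feasible\<close>.\<close>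
    also have "\<dots> \<le> (\<Sum>j=t+1..d+1. \<beta> j - \<beta> (d+1)) + real (d+1) * \<beta> (d+1)"
      using upos[OF w] by (intro add_left_mono mult_right_mono) (auto simp: \<beta>_def w_def)
    finally show "(\<Prod>i=1..t. \<beta> i - \<beta> (d+1)) \<le> (\<Sum>j=t+1..d+1. \<beta> j - \<beta> (d+1)) + real (d+1) * \<beta> (d+1)" .
  qed
  then have tau: "tau d \<le> (\<Prod>i=1..d. \<beta> i)" by (rule tau_le)
  have "card (V - {w}) = CARD('n)" using V w by simp
  then obtain g :: "'n \<Rightarrow> real^('n::_)" where g: "bij_betw g UNIV (V - {w})"
    using finite_same_card_bij[of "UNIV :: 'n set" "V - {w}"] V(1) by auto
  have "bij_betw e ({1..d+1} - {d+1}) (V - {w})"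
    using e w unfolding w_def by (intro bij_betw_DiffI) auto
  moreover have "{1..d+1} - {d+1} = {1..d}" by auto
  ultimately have "(\<Prod>i=1..d. \<beta> i) = (\<Prod>v\<in>V - {w}. u v)"
    unfolding \<beta>_def by (metis prod.reindex_bij_betw)
  also have "\<dots> = (\<Prod>i\<in>UNIV. u (g i))" by (rule prod.reindex_bij_betw[OF g, symmetric])
  finally have "measure lebesgue S * fact d * (\<Prod>i=1..d. \<beta> i) \<le> real k"
    using content_simplex_times_coords_le[OF V(1-3) finP(1) u(1) w g] by (simp add: d_def cardP V(5))
  moreover have "measure lebesgue S * fact d * tau d \<le> measure lebesgue S * fact d * (\<Prod>i=1..d. \<beta> i)"
    using tau by (intro mult_left_mono) auto
  ultimately have "measure lebesgue S * (fact d * tau d) \<le> real k" by (simp add: mult.assoc)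
  then show ?thesis
    using tau_pos[of d] by (simp add: pos_le_divide_eq d_def)
qed

theorem theorem2p2:
  fixes k :: nat
  assumes "k \<ge> 1"
  shows "tau CARD('n::finite) > 0 \<and>
         (\<forall>S \<in> lattice_simplices TYPE('n) k.
             measure lebesgue S \<le> real k / (fact CARD('n) * tau CARD('n)))"
proof (intro conjI ballI)
  show "tau CARD('n) > 0" by (rule tau_pos)
  fix S :: "(real^'n) set" assume "S \<in> lattice_simplices TYPE('n) k"
  \<comment> \<open>The bound is applied to the copy of \<open>S\<close> over the well-ordered type
    \<open>'n ordered\<close>, which has the same dimension and volume.\<close>
  note R = lattice_simplices_reindex[OF bij_Rep_ordered this]
  show "measure lebesgue S \<le> real k / (fact CARD('n) * tau CARD('n))"
    using lattice_simplex_content_le[OF assms R(1)] R(2) by (simp add: CARD_ordered)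
qed

end
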